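(* Let $k$ be an algebraically closed field, $A=k^{[2]}$, and let $F\in A$ be a pseudo field generator in $A$. Then $F$ is a good pseudo field generator in $A$ if and only if $F$ has at least one purely inseparable dicritical.
   Context: $k^{[2]}$ is a polynomial ring in two variables over $k$. $F$ is a pseudo field generator in $A$ if there exists $G\in\operatorname{Frac}A$ such that $\operatorname{Frac}A$ is purely inseparable over $k(F,G)$; it is good if such $G$ can be chosen in $A$. For a field $E$ contained in a domain $B$, $\mathbb P(B/E)$ denotes the set of valuation rings $\mathcal O$ with $E\subseteq\mathcal O\subsetneq\operatorname{Frac}B$ and $\operatorname{Frac}\mathcal O=\operatorname{Frac}B$, and $\mathbb P_\infty(B/E)=\{\mathcal O\in\mathbb P(B/E): B\not\subseteq\mathcal O\}$. For $F\in A\setminus k$, let $\mathcal A=S^{-1}A$ with $S=k[F]\setminus\{0\}$; the dicriticals of $F$ are the elements of $\mathbb P_\infty(\mathcal A/k(F))$. A dicritical is purely inseparable if its residue field is a purely inseparable extension of $k(F)$. *)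

theory Defs
  imports "HOL-Computational_Algebra.Polynomial" "HOL-Computational_Algebra.Fraction_Field"
begin

text \<open>k is modelled by a type 'k of class field; A = k^[2] is modelled as 'k poly poly
 (= k[X][Y]); Frac A is 'k poly poly fract.\<close>

definition alg_closed :: "'k::field itself \<Rightarrow> bool" where
  "alg_closed _ \<longleftrightarrow> (\<forall>p::'k poly. degree p > 0 \<longrightarrow> (\<exists>x. poly p x = 0))"

definition char_exp :: "'k::field itself \<Rightarrow> nat" where
  "char_exp _ = (if CHAR('k) = 0 then 1 else CHAR('k))"

definition is_subfield :: "'K::field set \<Rightarrow> bool" where
  "is_subfield S \<longleftrightarrow> 0 \<in> S \<and> 1 \<in> S \<and> (\<forall>x\<in>S. \<forall>y\<in>S. x + y \<in> S \<and> x * y \<in> S)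
     \<and> (\<forall>x\<in>S. - x \<in> S \<and> inverse x \<in> S)"

definition gen_field :: "'K::field set \<Rightarrow> 'K set" where
  "gen_field X = \<Inter>{S. is_subfield S \<and> X \<subseteq> S}"

text \<open>M is purely inseparable over L, where p is the characteristic exponent\<close>
definition purely_insep :: "nat \<Rightarrow> 'K::field set \<Rightarrow> 'K set \<Rightarrow> bool" where
  "purely_insep p L M \<longleftrightarrow> (\<forall>z\<in>M. \<exists>e::nat. z ^ (p ^ e) \<in> L)"

definition emb :: "'k::field poly poly \<Rightarrow> 'k poly poly fract" where
  "emb a = Fract a 1"

definition kconst :: "'k::field poly poly fract set" where
  "kconst = range (\<lambda>c. emb [:[:c:]:])"

definition pseudo_field_generator :: "'k::field poly poly \<Rightarrow> bool" where
  "pseudo_field_generator F \<longleftrightarrow>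
     (\<exists>G. purely_insep (char_exp TYPE('k)) (gen_field (kconst \<union> {emb F, G})) UNIV)"

definition good_pseudo_field_generator :: "'k::field poly poly \<Rightarrow> bool" where
  "good_pseudo_field_generator F \<longleftrightarrow>
     (\<exists>G::'k poly poly. purely_insep (char_exp TYPE('k)) (gen_field (kconst \<union> {emb F, emb G})) UNIV)"

definition kpoly_in :: "'k::field poly poly \<Rightarrow> 'k poly poly set" where
  "kpoly_in F = {poly (map_poly (\<lambda>c. [:[:c:]:]) r) F | r. True}"

definition loc_ring :: "'k::field poly poly \<Rightarrow> 'k poly poly fract set" where
  "loc_ring F = {Fract a s | a s. s \<in> kpoly_in F \<and> s \<noteq> 0}"

definition kF :: "'k::field poly poly \<Rightarrow> 'k poly poly fract set" where
  "kF F = gen_field (kconst \<union> {emb F})"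

definition valuation_ring :: "'K::field set \<Rightarrow> bool" where
  "valuation_ring R \<longleftrightarrow> 0 \<in> R \<and> 1 \<in> R \<and> (\<forall>x\<in>R. \<forall>y\<in>R. x + y \<in> R \<and> x * y \<in> R \<and> - x \<in> R)
     \<and> (\<forall>x. x \<noteq> 0 \<longrightarrow> x \<in> R \<or> inverse x \<in> R)"

definition max_ideal :: "'K::field set \<Rightarrow> 'K set" where
  "max_ideal R = {x \<in> R. x = 0 \<or> inverse x \<notin> R}"

text \<open>the dicriticals of F: elements of P_infinity(S^{-1}A / k(F))\<close>
definition dicriticals :: "'k::field poly poly \<Rightarrow> 'k poly poly fract set set" where
  "dicriticals F = {R. valuation_ring R \<and> kF F \<subseteq> R \<and> R \<noteq> UNIV
      \<and> (\<forall>z. \<exists>a\<in>R. \<exists>b\<in>R. b \<noteq> 0 \<and> z = a / b)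
      \<and> \<not> loc_ring F \<subseteq> R}"

text \<open>the residue field R/m_O is purely inseparable over (the image of) k(F)\<close>
definition purely_insep_dicritical :: "'k::field poly poly \<Rightarrow> 'k poly poly fract set \<Rightarrow> bool" where
  "purely_insep_dicritical F R \<longleftrightarrow>
     (\<forall>x\<in>R. \<exists>e::nat. \<exists>y\<in>kF F. x ^ (char_exp TYPE('k) ^ e) - y \<in> max_ideal R)"

end

theory Submission
  imports Defs "Berlekamp_Zassenhaus.Unique_Factorization_Poly"
begin

text \<open>Write \<open>L = k(F)\<close> and \<open>K = Frac A\<close>.

  If \<open>K\<close> is purely inseparable over \<open>L(G)\<close> with \<open>G \<in> A\<close>, the place \<open>G = \<infinity>\<close> of \<open>L(G)\<close> extends to a
  dicritical of \<open>F\<close> whose residue field is purely inseparable over \<open>L\<close>. That \<open>G\<close> is transcendental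
  over \<open>L\<close> follows from the existence of some nontrivial valuation ring containing \<open>L\<close>: if \<open>G\<close> were
  algebraic, such a ring would contain \<open>L(G)\<close>, hence \<open>K\<close>.

  Conversely, let \<open>R\<close> be a purely inseparable dicritical and let \<open>K\<close> be purely inseparable over
  \<open>L(G)\<close> with \<open>G \<in> K\<close>. Either \<open>u = 1/G\<close> or some \<open>u = G\<^sup>q - c\<close> with \<open>c \<in> L\<close> is a nonunit of \<open>R\<close>, and
  \<open>K\<close> is purely inseparable over \<open>L(u)\<close>. Then \<open>R\<close> is the only valuation ring over \<open>L\<close> that does not
  contain \<open>1/u\<close>. Since \<open>R\<close> does not contain \<open>S\<inverse>A\<close>, the element \<open>1/u\<close> lies in all localisations
  of the factorial ring \<open>A\<close> at primes dividing no element of \<open>S = k[F] - {0}\<close>, hence in \<open>S\<inverse>A\<close>.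
  Writing \<open>1/u = a/s\<close> with \<open>s \<in> S\<close>, we get \<open>L(u) = L(a)\<close> with \<open>a \<in> A\<close>.\<close>

section \<open>Subfields and simple extensions\<close>

lemma gen_field_subfield: "is_subfield (gen_field X)"
  by (auto simp: gen_field_def is_subfield_def)

lemma gen_field_incl: "X \<subseteq> gen_field X"
  by (auto simp: gen_field_def)

lemma gen_field_least: "is_subfield S \<Longrightarrow> X \<subseteq> S \<Longrightarrow> gen_field X \<subseteq> S"
  by (auto simp: gen_field_def)

lemma subfieldD:
  assumes "is_subfield L"
  shows "0 \<in> L" "1 \<in> L" "x \<in> L \<Longrightarrow> y \<in> L \<Longrightarrow> x + y \<in> L" "x \<in> L \<Longrightarrow> y \<in> L \<Longrightarrow> x * y \<in> L"
    "x \<in> L \<Longrightarrow> - x \<in> L" "x \<in> L \<Longrightarrow> inverse x \<in> L"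
    "x \<in> L \<Longrightarrow> y \<in> L \<Longrightarrow> x - y \<in> L" "x \<in> L \<Longrightarrow> y \<in> L \<Longrightarrow> x / y \<in> L"
    "x \<in> L \<Longrightarrow> x ^ n \<in> L"
proof -
  note L = assms[unfolded is_subfield_def]
  show "0 \<in> L" "1 \<in> L" "x \<in> L \<Longrightarrow> y \<in> L \<Longrightarrow> x + y \<in> L" "x \<in> L \<Longrightarrow> y \<in> L \<Longrightarrow> x * y \<in> L"
    "x \<in> L \<Longrightarrow> - x \<in> L" "x \<in> L \<Longrightarrow> inverse x \<in> L"
    using L by auto
  show "x \<in> L \<Longrightarrow> y \<in> L \<Longrightarrow> x - y \<in> L"
    using L by (metis diff_conv_add_uminus)
  show "x \<in> L \<Longrightarrow> y \<in> L \<Longrightarrow> x / y \<in> L"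
    using L by (metis divide_inverse)
  show "x \<in> L \<Longrightarrow> x ^ n \<in> L"
    using L by (induction n) auto
qed

text \<open>Subfields are sets here, not types, so \<open>L[X]\<close> is carved out of the
  polynomials over the big field by a predicate.\<close>

definition over :: "'K::field set \<Rightarrow> 'K poly \<Rightarrow> bool" where
  "over L P \<longleftrightarrow> (\<forall>i. coeff P i \<in> L)"

context
  fixes L :: "'K::field set"
  assumes L: "is_subfield L"
begin

lemma over_0: "over L 0" and over_1: "over L 1"
  using subfieldD[OF L] by (auto simp: over_def)

lemma over_add: "over L P \<Longrightarrow> over L Q \<Longrightarrow> over L (P + Q)"
  and over_diff: "over L P \<Longrightarrow> over L Q \<Longrightarrow> over L (P - Q)"
  and over_uminus: "over L P \<Longrightarrow> over L (- P)"
  using subfieldD[OF L] by (auto simp: over_def)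

lemma over_smult: "c \<in> L \<Longrightarrow> over L P \<Longrightarrow> over L (smult c P)"
  using subfieldD[OF L] by (auto simp: over_def)

lemma over_monom: "c \<in> L \<Longrightarrow> over L (monom c n)"
  using subfieldD[OF L] by (auto simp: over_def)

lemma over_pCons: "over L (pCons c P) \<longleftrightarrow> c \<in> L \<and> over L P"
  by (force simp: over_def coeff_pCons split: nat.split)

lemma over_mult: "over L P \<Longrightarrow> over L Q \<Longrightarrow> over L (P * Q)"
proof (induction P)
  case (pCons c P)
  then show ?case
    by (auto simp: over_pCons over_add over_smult subfieldD[OF L])
qed (simp add: over_0)

lemma over_power: "over L P \<Longrightarrow> over L (P ^ n)"
  by (induction n) (auto simp: over_1 over_mult)

lemma over_reflect: "over L P \<Longrightarrow> over L (reflect_poly P)"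
  using subfieldD[OF L] by (auto simp: over_def coeff_reflect_poly)

lemma over_lead_coeff: "over L P \<Longrightarrow> lead_coeff P \<in> L"
  by (auto simp: over_def)

lemmas over_closed = over_0 over_1 over_add over_diff over_uminus over_smult over_monom
  over_mult over_power

text \<open>Long division: the monomial that cancels the leading term of \<open>A\<close> has its
  coefficient in \<open>L\<close>, so no step leaves \<open>L[X]\<close>.\<close>

lemma over_division:
  assumes "over L A" "over L B" "B \<noteq> 0"
  shows "\<exists>Q R. over L Q \<and> over L R \<and> A = B * Q + R \<and> (R = 0 \<or> degree R < degree B)"
  using assms(1)
proof (induction "degree A" arbitrary: A rule: less_induct)
  case less
  show ?case
  proof (cases "A = 0 \<or> degree A < degree B")
    case True
    with less.prems show ?thesis by (intro exI[of _ 0] exI[of _ A]) (auto simp: over_0)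
  next
    case False
    define M where "M = monom (lead_coeff A / lead_coeff B) (degree A - degree B)"
    have M: "over L M"
      unfolding M_def using less.prems assms
      by (intro over_monom subfieldD(8)[OF L] over_lead_coeff)
    have M0: "M \<noteq> 0" using False assms(3) by (simp add: M_def)
    have degBM: "degree (B * M) = degree A"
      using False assms(3) M0 by (simp add: degree_mult_eq M_def degree_monom_eq)
    have "lead_coeff (B * M) = lead_coeff A"
      using assms(3) False by (subst lead_coeff_mult) (simp add: M_def degree_monom_eq)
    then have "coeff (A - B * M) (degree A) = 0" using degBM by simp
    moreover have "degree (A - B * M) \<le> degree A" using degBM by (simp add: degree_diff_le)
    ultimately consider "A - B * M = 0" | "degree (A - B * M) < degree A"
      using eq_zero_or_degree_less by blast
    then show ?thesis
    proof cases
      case 1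
      then have "A = B * M + 0" by simp
      with M over_0 show ?thesis by blast
    next
      case 2
      have "over L (A - B * M)" using less.prems M assms by (intro over_closed)
      from less.hyps[OF 2 this] obtain Q R where
        *: "over L Q" "over L R" "A - B * M = B * Q + R" "R = 0 \<or> degree R < degree B" by blast
      from *(3) have "A = B * (M + Q) + R" by (simp add: algebra_simps)
      with * M show ?thesis by (intro exI[of _ "M + Q"] exI[of _ R]) (simp add: over_add)
    qed
  qed
qed

text \<open>This makes \<open>L[g]\<close> a field for algebraic \<open>g\<close>. Let
  \<open>M\<close> have least degree among the nonzero polynomials over \<open>L\<close> that vanish
  at \<open>g\<close>. A large \<open>Q\<close> is reduced modulo \<open>M\<close>; a small one
  divides \<open>M\<close> with a remainder, and inverting the remainder at \<open>g\<close> inverts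
  \<open>Q\<close> at \<open>g\<close>.\<close>

lemma algebraic_inverse:
  assumes "over L P" "P \<noteq> 0" "poly P g = 0" "over L Q" "poly Q g \<noteq> 0"
  shows "\<exists>H. over L H \<and> poly Q g * poly H g = 1"
proof -
  obtain M where M: "over L M" "M \<noteq> 0" "poly M g = 0"
    and least: "\<And>N. over L N \<Longrightarrow> N \<noteq> 0 \<Longrightarrow> poly N g = 0 \<Longrightarrow> degree M \<le> degree N"
    using ex_has_least_nat[of "\<lambda>N. over L N \<and> N \<noteq> 0 \<and> poly N g = 0" P degree] assms by auto
  show ?thesis using assms(4,5)
  proof (induction "degree Q" arbitrary: Q rule: less_induct)
    case less
    have Q0: "Q \<noteq> 0" using less.prems by auto
    consider "degree Q = 0" | "degree M \<le> degree Q" "degree Q > 0"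
      | "degree Q < degree M" "degree Q > 0" by linarith
    then show ?case
    proof cases
      case 1
      then obtain c where c: "Q = [:c:]" by (rule degree_eq_zeroE)
      with less.prems show ?thesis
        by (intro exI[of _ "[:inverse c:]"]) (auto simp: over_pCons over_0 subfieldD[OF L])
    next
      case 2
      obtain H R where HR: "over L H" "over L R" "Q = M * H + R" "R = 0 \<or> degree R < degree M"
        using over_division[OF less.prems(1) M(1,2)] by blast
      have R: "poly R g = poly Q g" using HR M by simp
      then have "R \<noteq> 0" using less.prems(2) by auto
      with HR(4) 2(1) have "degree R < degree Q" by linarith
      from less.hyps[OF this HR(2)] R less.prems(2) show ?thesis by simp
    next
      case 3
      obtain H R where HR: "over L H" "over L R" "M = Q * H + R" "R = 0 \<or> degree R < degree Q"
        using over_division[OF M(1) less.prems(1) Q0] by blast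
      have degR: "degree R < degree Q" using HR 3 by auto
      have eq: "poly Q g * poly H g + poly R g = 0" using HR M by (metis poly_add poly_mult)
      have H0: "H \<noteq> 0" using HR degR 3 by auto
      have degQH: "degree (Q * H) = degree Q + degree H" using Q0 H0 by (rule degree_mult_eq)
      then have "degree M = degree (Q * H)"
        unfolding HR(3) using degR by (intro degree_add_eq_left) linarith
      \<comment> \<open>As \<open>Q\<close> has positive degree, \<open>H\<close> is shorter than
        \<open>M\<close>, so minimality forbids a zero of \<open>H\<close> at \<open>g\<close>;
        hence the remainder does not vanish there either.\<close>
      with degQH 3 have "degree H < degree M" by linarith
      with least[of H] H0 HR(1) have "poly H g \<noteq> 0" by linarith
      with eq less.prems(2) have "poly R g \<noteq> 0" by auto
      from less.hyps[OF degR HR(2) this] obtain S where S: "over L S" "poly R g * poly S g = 1"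
        by blast
      have "poly Q g * poly (- (H * S)) g = 1"
      proof -
        have "poly Q g * poly (- (H * S)) g = - (poly Q g * poly H g) * poly S g" by simp
        also have "- (poly Q g * poly H g) = poly R g" using eq by (metis add_eq_0_iff)
        finally show ?thesis using S(2) by simp
      qed
      with S(1) HR(1) show ?thesis by (intro exI[of _ "- (H * S)"]) (auto intro: over_closed)
    qed
  qed
qed

lemma gen_field_algebraic:
  assumes "over L P" "P \<noteq> 0" "poly P g = 0"
  shows "gen_field (L \<union> {g}) \<subseteq> {poly Q g | Q. over L Q}"
proof (rule gen_field_least)
  show "is_subfield {poly Q g | Q. over L Q}"
    unfolding is_subfield_def
  proof (intro conjI ballI)
    show "0 \<in> {poly Q g | Q. over L Q}" by (auto intro!: exI[of _ 0] over_0)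
    show "1 \<in> {poly Q g | Q. over L Q}" by (auto intro!: exI[of _ 1] over_1)
  next
    fix x y assume "x \<in> {poly Q g | Q. over L Q}" "y \<in> {poly Q g | Q. over L Q}"
    then obtain A B where "over L A" "over L B" "x = poly A g" "y = poly B g" by auto
    then show "x + y \<in> {poly Q g | Q. over L Q}" "x * y \<in> {poly Q g | Q. over L Q}"
      by (auto intro: exI[of _ "A + B"] exI[of _ "A * B"] over_closed)
  next
    fix x assume "x \<in> {poly Q g | Q. over L Q}"
    then obtain A where A: "over L A" "x = poly A g" by auto
    then show "- x \<in> {poly Q g | Q. over L Q}"
      by (auto intro!: exI[of _ "- A"] over_closed)
    show "inverse x \<in> {poly Q g | Q. over L Q}"
    proof (cases "x = 0")
      case True
      then show ?thesis by (auto intro!: exI[of _ 0] over_0)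
    next
      case False
      with algebraic_inverse[OF assms A(1)] A(2) obtain H where "over L H" "x * poly H g = 1"
        by auto
      then have "inverse x = poly H g" by (simp add: inverse_unique)
      with \<open>over L H\<close> show ?thesis by auto
    qed
  qed
  have I: "poly Q g \<in> {poly Q g | Q. over L Q}" if "over L Q" for Q
    using that by blast
  have "c \<in> L \<Longrightarrow> over L [:c:]" "over L [:0,1:]" for c
    by (auto simp: over_pCons over_0 over_1 subfieldD[OF L])
  then show "L \<union> {g} \<subseteq> {poly Q g | Q. over L Q}"
    using I[of "[:c:]" for c] I[of "[:0,1:]"] by auto
qed

lemma gen_field_simple:
  "gen_field (L \<union> {g}) \<subseteq> {poly P g / poly Q g | P Q. over L P \<and> over L Q \<and> poly Q g \<noteq> 0}"
    (is "_ \<subseteq> ?S")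
proof (rule gen_field_least)
  have I: "poly P g / poly Q g \<in> ?S" if "over L P" "over L Q" "poly Q g \<noteq> 0" for P Q
    using that by blast
  show "is_subfield ?S"
    unfolding is_subfield_def
  proof (intro conjI ballI)
    show "0 \<in> ?S" using I[of 0 1] over_0 over_1 by simp
    show "1 \<in> ?S" using I[of 1 1] over_1 by simp
  next
    fix x y assume "x \<in> ?S" "y \<in> ?S"
    then obtain A B C D where *: "over L A" "over L B" "x = poly A g / poly B g" "poly B g \<noteq> 0"
      "over L C" "over L D" "y = poly C g / poly D g" "poly D g \<noteq> 0" by blast
    have "x + y = poly (A * D + C * B) g / poly (B * D) g" "x * y = poly (A * C) g / poly (B * D) g"
      unfolding *(3,7) using *(4,8) by (simp_all add: add_frac_eq)
    then show "x + y \<in> ?S" "x * y \<in> ?S"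
      using * I[of "A * D + C * B" "B * D"] I[of "A * C" "B * D"] by (simp_all add: over_closed)
  next
    fix x assume "x \<in> ?S"
    then obtain A B where *: "over L A" "over L B" "x = poly A g / poly B g" "poly B g \<noteq> 0" by blast
    then show "- x \<in> ?S" using I[of "- A" B] by (simp add: over_closed)
    \<comment> \<open>Since \<open>inverse 0 = 0\<close>, a vanishing numerator needs the witness
      \<open>0 / 1\<close>.\<close>
    show "inverse x \<in> ?S"
      using * I[of B A] I[of 0 1] by (cases "poly A g = 0") (auto simp: over_0 over_1)
  qed
  have "c \<in> L \<Longrightarrow> over L [:c:]" "over L [:0,1:]" for c
    by (auto simp: over_pCons over_0 over_1 subfieldD[OF L])
  then show "L \<union> {g} \<subseteq> ?S"
    using I[of "[:c:]" 1 for c] I[of "[:0,1:]" 1] by (auto simp: over_1)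
qed

end

section \<open>Valuation rings\<close>

context
  fixes R :: "'K::field set"
  assumes R: "valuation_ring R"
begin

lemma val_0: "0 \<in> R"
  using R unfolding valuation_ring_def by blast

lemma val_1: "1 \<in> R"
  and val_add: "x \<in> R \<Longrightarrow> y \<in> R \<Longrightarrow> x + y \<in> R"
  and val_mult: "x \<in> R \<Longrightarrow> y \<in> R \<Longrightarrow> x * y \<in> R"
  and val_uminus: "x \<in> R \<Longrightarrow> - x \<in> R"
  using R unfolding valuation_ring_def by blast+

lemma val_total: "x \<in> R \<or> inverse x \<in> R"
proof (cases "x = 0")
  case False
  then show ?thesis using R unfolding valuation_ring_def by blast
qed (simp add: val_0)

lemma val_power: "x \<in> R \<Longrightarrow> x ^ n \<in> R"
  by (induction n) (auto simp: val_1 val_mult)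

lemma val_poly: "L \<subseteq> R \<Longrightarrow> over L P \<Longrightarrow> x \<in> R \<Longrightarrow> poly P x \<in> R"
proof (induction P)
  case (pCons a P)
  then have "over L P" "a \<in> L"
    by (auto simp: over_def coeff_pCons split: nat.splits)
  with pCons show ?case by (auto intro!: val_add val_mult)
qed (simp add: val_0)

lemma max_ideal_mult:
  assumes "x \<in> max_ideal R" "y \<in> R"
  shows "x * y \<in> max_ideal R"
proof (rule ccontr)
  assume "x * y \<notin> max_ideal R"
  with assms have *: "x * y \<noteq> 0" "inverse (x * y) \<in> R" by (auto simp: max_ideal_def val_mult)
  then have "inverse (x * y) * y = inverse x" by (simp add: field_simps)
  with val_mult[OF *(2) assms(2)] have "inverse x \<in> R" by metis
  with assms(1) *(1) show False by (simp add: max_ideal_def)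
qed

text \<open>One of the quotients \<open>y / x\<close> and \<open>x / y\<close> lies in
  \<open>R\<close>, so the sum is an element of the maximal ideal times an element of
  \<open>R\<close>.\<close>

lemma max_ideal_add:
  assumes "x \<in> max_ideal R" "y \<in> max_ideal R"
  shows "x + y \<in> max_ideal R"
proof (cases "x = 0 \<or> y = 0")
  case True
  with assms show ?thesis by auto
next
  case False
  then have *: "x + y = x * (1 + y * inverse x)" "x + y = y * (1 + x * inverse y)"
    by (auto simp: field_simps)
  have "y * inverse x \<in> R \<or> x * inverse y \<in> R"
    using val_total[of "y * inverse x"] by (simp add: mult.commute)
  then show ?thesis
    using * max_ideal_mult assms val_1 val_add by metis
qed

lemma inverse_max_ideal: "x \<notin> R \<Longrightarrow> inverse x \<in> max_ideal R"
  using val_total[of x] by (auto simp: max_ideal_def)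

lemma power_max_ideal: "x \<in> max_ideal R \<Longrightarrow> n > 0 \<Longrightarrow> x ^ n \<in> max_ideal R"
  using max_ideal_mult[OF _ val_power, of x x "n - 1"]
  by (cases n) (simp_all add: max_ideal_def)

text \<open>A case of integral closedness: if \<open>x\<close> is outside \<open>R\<close>, the
  positive powers of \<open>1 / x\<close> are nonunits. It brings membership back from a power to
  the element itself.\<close>

lemma val_root: "x ^ n \<in> R \<Longrightarrow> n > 0 \<Longrightarrow> x \<in> R"
proof (rule ccontr)
  assume *: "x ^ n \<in> R" "n > 0" "x \<notin> R"
  then have "inverse x ^ n \<in> max_ideal R" by (intro power_max_ideal inverse_max_ideal)
  moreover have "x \<noteq> 0" using * val_0 by auto
  ultimately show False using *(1) by (simp add: max_ideal_def power_inverse)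
qed

lemma val_unit_add:
  assumes "a \<in> R" "inverse a \<in> R" "a \<noteq> 0" "x \<in> max_ideal R"
  shows "a + x \<noteq> 0 \<and> a + x \<in> R \<and> inverse (a + x) \<in> R"
proof -
  have "a + x \<notin> max_ideal R"
  proof
    assume "a + x \<in> max_ideal R"
    moreover have "- x \<in> max_ideal R"
      using max_ideal_mult[OF assms(4) val_uminus[OF val_1]] by simp
    ultimately have "a + x + - x \<in> max_ideal R" by (rule max_ideal_add)
    with assms show False by (simp add: max_ideal_def)
  qed
  moreover have "a + x \<in> R" using assms by (auto simp: max_ideal_def intro: val_add)
  ultimately show ?thesis by (auto simp: max_ideal_def)
qed

text \<open>The criterion involves only the exponents, so two valuation rings in which
  \<open>u\<close> is a nonunit and \<open>x\<close>, \<open>y\<close> are units agree on such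
  quotients.\<close>

lemma val_power_unit:
  assumes "u \<in> max_ideal R" "u \<noteq> 0" "x \<in> R" "inverse x \<in> R" "x \<noteq> 0" "y \<in> R" "inverse y \<in> R" "y \<noteq> 0"
  shows "u ^ n * x / (u ^ m * y) \<in> R \<longleftrightarrow> m \<le> n"
proof
  have uR: "u \<in> R" using assms(1) by (simp add: max_ideal_def)
  show "u ^ n * x / (u ^ m * y) \<in> R" if "m \<le> n"
  proof -
    have "u ^ n * x / (u ^ m * y) = u ^ (n - m) * x * inverse y"
      using that assms by (simp add: field_simps power_diff)
    then show ?thesis using assms uR by (auto intro!: val_mult val_power)
  qed
  show "m \<le> n" if *: "u ^ n * x / (u ^ m * y) \<in> R"
  proof (rule ccontr)
    assume "\<not> m \<le> n"
    then have "m - n > 0" "u ^ m = u ^ (m - n) * u ^ n" by (auto simp flip: power_add)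
    then have "inverse (u ^ (m - n)) = u ^ n * x / (u ^ m * y) * y * inverse x"
      using assms by (simp add: field_simps)
    also have "\<dots> \<in> R" using val_mult[OF val_mult[OF * assms(6)] assms(4)] .
    finally show False
      using power_max_ideal[OF assms(1) \<open>m - n > 0\<close>] assms(2) by (simp add: max_ideal_def)
  qed
qed

end

section \<open>Valuation rings containing a subfield \<open>L\<close>\<close>

lemma algebraic_in_valuation_ring:
  assumes L: "is_subfield L" and V: "valuation_ring V" "L \<subseteq> V"
    and P: "over L P" "P \<noteq> 0" "poly P g = 0"
  shows "gen_field (L \<union> {g}) \<subseteq> V"
proof -
  \<comment> \<open>For algebraic \<open>u\<close> the field \<open>L(u)\<close> is
    \<open>L[u]\<close>, so it lies in \<open>V\<close> as soon as \<open>u\<close> does. This is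
    applied to \<open>g\<close> or to \<open>1 / g\<close>, a root of the reversed
    polynomial.\<close>
  have *: "gen_field (L \<union> {u}) \<subseteq> V" if "u \<in> V" "over L Q" "Q \<noteq> 0" "poly Q u = 0" for u Q
    using gen_field_algebraic[OF L that(2-4)] val_poly[OF V _ that(1)] by blast
  show ?thesis
  proof (cases "g \<in> V")
    case True
    with * P show ?thesis by blast
  next
    case False
    then have g0: "g \<noteq> 0" using val_0[OF V(1)] by auto
    have "inverse g \<in> V" using val_total[OF V(1), of g] False by auto
    moreover have "poly (reflect_poly P) (inverse g) = 0"
      using g0 P by (simp add: poly_reflect_poly_nz)
    moreover have "reflect_poly P \<noteq> 0" using P by simp
    ultimately have "gen_field (L \<union> {inverse g}) \<subseteq> V" using over_reflect[OF L P(1)] * by blast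
    moreover have "L \<union> {g} \<subseteq> gen_field (L \<union> {inverse g})"
      using gen_field_incl[of "L \<union> {inverse g}"] gen_field_subfield[of "L \<union> {inverse g}"]
      by (metis Un_insert_right insert_subset inverse_inverse_eq subfieldD(6) sup_bot.right_neutral)
    ultimately show ?thesis using gen_field_least[OF gen_field_subfield] by blast
  qed
qed

text \<open>If \<open>g\<close> were algebraic, \<open>V\<close> would contain \<open>L(g)\<close>
  and then, by \<open>val_root\<close>, the whole field.\<close>

lemma transcendental_if_purely_insep:
  assumes L: "is_subfield L" and V: "valuation_ring V" "L \<subseteq> V" "V \<noteq> UNIV"
    and "p > 0" "purely_insep p (gen_field (L \<union> {g})) UNIV"
    and "over L P" "poly P g = 0"
  shows "P = 0"
proof (rule ccontr)
  assume "P \<noteq> 0"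
  from algebraic_in_valuation_ring[OF L V(1,2) assms(7) this assms(8)]
  have sub: "gen_field (L \<union> {g}) \<subseteq> V" .
  have "z \<in> V" for z
  proof -
    obtain e where "z ^ (p ^ e) \<in> gen_field (L \<union> {g})"
      using assms(6) by (auto simp: purely_insep_def)
    with sub have "z ^ (p ^ e) \<in> V" by blast
    then show ?thesis using val_root[OF V(1)] \<open>p > 0\<close> by simp
  qed
  with V(3) show False by blast
qed

text \<open>Factors \<open>u\<close> are split off until the constant coefficient is nonzero. That
  coefficient is a unit of both rings, and the remaining terms lie in both maximal ideals. The same
  \<open>n\<close> and \<open>x\<close> serve both rings, which is what makes the rings
  comparable.\<close>

lemma val_poly_unit:
  assumes L: "is_subfield L" and V: "valuation_ring R" "L \<subseteq> R" "u \<in> max_ideal R"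
    and V': "valuation_ring R'" "L \<subseteq> R'" "u \<in> max_ideal R'"
    and "over L P" "poly P u \<noteq> 0"
  shows "\<exists>n x. poly P u = u ^ n * x \<and> x \<noteq> 0 \<and> x \<in> R \<and> inverse x \<in> R \<and> x \<in> R' \<and> inverse x \<in> R'"
  using assms(8,9)
proof (induction P)
  case (pCons a P)
  then have aP: "a \<in> L" "over L P" by (auto simp: over_pCons[OF L])
  have u: "u \<in> R" "u \<in> R'" using V V' by (auto simp: max_ideal_def)
  show ?case
  proof (cases "a = 0")
    case True
    with pCons.prems have "poly P u \<noteq> 0" by auto
    from pCons.IH[OF aP(2) this] obtain n x where
      "poly P u = u ^ n * x \<and> x \<noteq> 0 \<and> x \<in> R \<and> inverse x \<in> R \<and> x \<in> R' \<and> inverse x \<in> R'"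
      by blast
    with True show ?thesis by (intro exI[of _ "Suc n"] exI[of _ x]) auto
  next
    case False
    have a: "a \<in> R" "inverse a \<in> R" "a \<in> R'" "inverse a \<in> R'"
      using V(2) V'(2) aP(1) subfieldD(6)[OF L aP(1)] by auto
    have "u * poly P u \<in> max_ideal R" "u * poly P u \<in> max_ideal R'"
      using max_ideal_mult[OF V(1,3) val_poly[OF V(1,2) aP(2) u(1)]]
        max_ideal_mult[OF V'(1,3) val_poly[OF V'(1,2) aP(2) u(2)]] by auto
    from val_unit_add[OF V(1) a(1,2) False this(1)] val_unit_add[OF V'(1) a(3,4) False this(2)]
    have "poly (pCons a P) u = u ^ 0 * (a + u * poly P u) \<and> a + u * poly P u \<noteq> 0
        \<and> a + u * poly P u \<in> R \<and> inverse (a + u * poly P u) \<in> R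
        \<and> a + u * poly P u \<in> R' \<and> inverse (a + u * poly P u) \<in> R'"
      by simp
    then show ?thesis by blast
  qed
qed simp

text \<open>Some power of each element of the field lies in \<open>L(u)\<close>, and a nonzero element of \<open>L(u)\<close>
  is a power of \<open>u\<close> times a common unit of both rings.\<close>
lemma valuation_ring_le:
  assumes L: "is_subfield L" and V: "valuation_ring R" "L \<subseteq> R" "u \<in> max_ideal R"
    and V': "valuation_ring R'" "L \<subseteq> R'" "u \<in> max_ideal R'"
    and u0: "u \<noteq> 0" and p: "p > 0" "purely_insep p (gen_field (L \<union> {u})) UNIV"
  shows "R \<subseteq> R'"
proof
  fix z assume z: "z \<in> R"
  obtain e where "z ^ (p ^ e) \<in> gen_field (L \<union> {u})"
    using p(2) by (auto simp: purely_insep_def)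
  with gen_field_simple[OF L, of u] have
    "z ^ (p ^ e) \<in> {poly P u / poly Q u | P Q. over L P \<and> over L Q \<and> poly Q u \<noteq> 0}" by (rule subsetD)
  then obtain P Q where
    PQ: "over L P" "over L Q" "poly Q u \<noteq> 0" and w: "z ^ (p ^ e) = poly P u / poly Q u" by auto
  have "z ^ (p ^ e) \<in> R'"
  proof (cases "poly P u = 0")
    case True
    with w val_0[OF V'(1)] show ?thesis by (metis div_0)
  next
    case False
    obtain n x where x: "poly P u = u ^ n * x" "x \<noteq> 0" "x \<in> R" "inverse x \<in> R" "x \<in> R'" "inverse x \<in> R'"
      using val_poly_unit[OF L V V' PQ(1) False] by blast
    obtain m y where y: "poly Q u = u ^ m * y" "y \<noteq> 0" "y \<in> R" "inverse y \<in> R" "y \<in> R'" "inverse y \<in> R'"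
      using val_poly_unit[OF L V V' PQ(2) PQ(3)] by blast
    have "z ^ (p ^ e) \<in> R" using z by (rule val_power[OF V(1)])
    \<comment> \<open>Membership in \<open>R\<close> forces this inequality, and the inequality in
      turn forces membership in \<open>R'\<close>.\<close>
    then have "m \<le> n"
      using val_power_unit[OF V(1,3) u0 x(3,4,2) y(3,4,2)] w x(1) y(1) by metis
    then show ?thesis
      using val_power_unit[OF V'(1,3) u0 x(5,6,2) y(5,6,2)] w x(1) y(1) by metis
  qed
  then show "z \<in> R'" using val_root[OF V'(1)] p(1) by simp
qed

section \<open>Purely inseparable extensions\<close>


lemma char_exp_pos: "char_exp TYPE('k::field) > 0"
  by (simp add: char_exp_def)

text \<open>\<open>Frac A\<close> inherits the characteristic of \<open>k\<close>. In characteristic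
  0 the exponent is 1 and the identity is trivial.\<close>

lemma char_exp_frobenius:
  fixes x y :: "'k::field poly poly fract"
  shows "(x + y) ^ (char_exp TYPE('k) ^ e) = x ^ (char_exp TYPE('k) ^ e) + y ^ (char_exp TYPE('k) ^ e)"
proof (cases "CHAR('k) = 0")
  case False
  have eq: "(of_nat n :: 'k poly poly fract) = 0 \<longleftrightarrow> (of_nat n :: 'k) = 0" for n
    by (simp add: Fract_of_nat_eq[symmetric] eq_fract Zero_fract_def of_nat_poly)
  have "CHAR('k poly poly fract) = CHAR('k)"
    by (rule CHAR_eqI) (auto simp: eq of_nat_eq_0_iff_char_dvd)
  moreover have "prime CHAR('k)" using False by (intro prime_CHAR_semidom) simp
  ultimately show ?thesis using False freshmans_dream'[where 'a = "'k poly poly fract"]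
    by (simp add: char_exp_def)
qed (simp add: char_exp_def)

text \<open>By \<open>frob\<close> the \<open>q\<close>-th power map is a ring endomorphism, and
  subfields pull back along it.\<close>

lemma frobenius_subfield:
  fixes M :: "'K::field set"
  assumes M: "is_subfield M" and q: "(q::nat) > 0"
    and frob: "\<And>x y :: 'K. (x + y) ^ q = x ^ q + y ^ q"
  shows "is_subfield {x. x ^ q \<in> M}"
  unfolding is_subfield_def
proof (intro conjI ballI)
  show "0 \<in> {x. x ^ q \<in> M}" "1 \<in> {x. x ^ q \<in> M}"
    using subfieldD(1,2)[OF M] q by (simp_all add: zero_power)
next
  fix x y assume "x \<in> {x. x ^ q \<in> M}" "y \<in> {x. x ^ q \<in> M}"
  then show "x + y \<in> {x. x ^ q \<in> M}" "x * y \<in> {x. x ^ q \<in> M}"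
    by (auto simp: frob power_mult_distrib intro: subfieldD[OF M])
next
  fix x assume x: "x \<in> {x. x ^ q \<in> M}"
  \<comment> \<open>The sign rule comes from additivity, whatever the parity of
    \<open>q\<close>.\<close>
  have "x ^ q + (- x) ^ q = 0" using frob[of x "- x"] q by (simp add: zero_power)
  then have "(- x) ^ q = - (x ^ q)" by (metis minus_unique)
  with x show "- x \<in> {x. x ^ q \<in> M}" by (auto intro: subfieldD[OF M])
  show "inverse x \<in> {x. x ^ q \<in> M}" using x by (auto simp: power_inverse intro: subfieldD[OF M])
qed

text \<open>This exchanges one set of generators for another. The preimage of \<open>M\<close> under
  the \<open>p ^ f\<close>-th power map is a field containing \<open>X\<close>, hence
  \<open>gen_field X\<close>, and the exponents \<open>e\<close> and \<open>f\<close> add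
  up.\<close>

lemma purely_insep_trans:
  fixes M :: "'K::field set"
  assumes "is_subfield M" "p > 0" "X \<subseteq> {x. x ^ (p ^ f) \<in> M}" "purely_insep p (gen_field X) UNIV"
    and frob: "\<And>x y :: 'K. \<And>e. (x + y) ^ (p ^ e) = x ^ (p ^ e) + y ^ (p ^ e)"
  shows "purely_insep p M UNIV"
  unfolding purely_insep_def
proof
  fix z
  obtain e where "z ^ (p ^ e) \<in> gen_field X" using assms(4) by (auto simp: purely_insep_def)
  moreover have "gen_field X \<subseteq> {x. x ^ (p ^ f) \<in> M}"
    using assms(2) by (intro gen_field_least[OF frobenius_subfield] assms frob) simp_all
  ultimately have "z ^ (p ^ (e + f)) \<in> M" by (auto simp: power_add power_mult)
  then show "\<exists>e. z ^ (p ^ e) \<in> M" ..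
qed

text \<open>The valuation ring below is the place \<open>g = \<infinity>\<close> of \<open>L(g)\<close>, extended to \<open>'K\<close>.\<close>
lemma place_at_infinity:
  fixes g :: "'K::field"
  assumes L: "is_subfield L" and p: "p > 0"
    and frob: "\<And>x y :: 'K. \<And>e. (x + y) ^ (p ^ e) = x ^ (p ^ e) + y ^ (p ^ e)"
    and insep: "purely_insep p (gen_field (L \<union> {g})) UNIV"
    and trans: "\<And>P. over L P \<Longrightarrow> poly P g = 0 \<Longrightarrow> P = 0"
  shows "\<exists>R. valuation_ring R \<and> L \<subseteq> R \<and> g \<notin> R \<and>
    (\<forall>x\<in>R. \<exists>e. \<exists>y\<in>L. x ^ (p ^ e) - y \<in> max_ideal R)"
proof -
  \<comment> \<open>\<open>V\<close> is the ring of rational functions in \<open>g\<close> that are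
    finite at infinity; \<open>R\<close> collects the elements of the big field with some
    \<open>p ^ e\<close>-th power in \<open>V\<close>.\<close>
  define V where "V = {poly A g / poly B g | A B.
    over L A \<and> over L B \<and> B \<noteq> 0 \<and> degree A \<le> degree B}"
  define R where "R = {z. \<exists>e. z ^ (p ^ e) \<in> V}"
  have V_I: "poly A g / poly B g \<in> V"
    if "over L A" "over L B" "B \<noteq> 0" "degree A \<le> degree B" for A B
    using that unfolding V_def by blast
  have V_E: thesis if "x \<in> V" "\<And>A B. over L A \<Longrightarrow> over L B \<Longrightarrow> B \<noteq> 0 \<Longrightarrow> degree A \<le> degree B
      \<Longrightarrow> x = poly A g / poly B g \<Longrightarrow> thesis" for x thesis
    using that unfolding V_def by blast
  have nz: "poly B g \<noteq> 0" if "over L B" "B \<noteq> 0" for B using trans that by blast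
  have const: "c \<in> V" if "c \<in> L" for c
    using V_I[of "[:c:]" 1] that by (auto simp: over_pCons[OF L] over_0[OF L] over_1[OF L])
  have V_add: "x + y \<in> V" and V_mult: "x * y \<in> V" if "x \<in> V" "y \<in> V" for x y
  proof -
    obtain A B where A: "over L A" "over L B" "B \<noteq> 0" "degree A \<le> degree B" "x = poly A g / poly B g"
      using \<open>x \<in> V\<close> by (rule V_E)
    obtain C D where C: "over L C" "over L D" "D \<noteq> 0" "degree C \<le> degree D" "y = poly C g / poly D g"
      using \<open>y \<in> V\<close> by (rule V_E)
    have deg: "degree (B * D) = degree B + degree D" using A C by (simp add: degree_mult_eq)
    have "degree (A * D + C * B) \<le> degree (B * D)" "degree (A * C) \<le> degree (B * D)"
      unfolding deg using A(4) C(4) degree_mult_le[of A D] degree_mult_le[of C B] degree_mult_le[of A C]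
      by (auto intro!: degree_add_le)
    moreover have "x + y = poly (A * D + C * B) g / poly (B * D) g"
      unfolding A(5) C(5) using nz[OF A(2,3)] nz[OF C(2,3)] by (simp add: add_frac_eq)
    moreover have "x * y = poly (A * C) g / poly (B * D) g"
      unfolding A(5) C(5) by simp
    ultimately show "x + y \<in> V" "x * y \<in> V"
      using V_I[of "A * D + C * B" "B * D"] V_I[of "A * C" "B * D"] A(1,2,3) C(1,2,3)
      by (simp_all add: over_closed[OF L])
  qed
  have V_power: "x ^ n \<in> V" if "x \<in> V" for x n
    using that by (induction n) (auto intro: const subfieldD[OF L] V_mult)
  have R_lift: "z ^ (p ^ (e + f)) \<in> V" if "z ^ (p ^ e) \<in> V" for z e f
    using V_power[OF that] by (simp add: power_add power_mult)
  have R_V: "x \<in> R" if "x \<in> V" for x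
    unfolding R_def using that by (auto intro: exI[of _ 0])
  \<comment> \<open>A nonzero quotient vanishing at infinity is a nonunit of \<open>R\<close>: by
    transcendence the equation at \<open>g\<close> becomes a polynomial identity, and its two sides
    differ in degree.\<close>
  have pole: "inverse (poly A g / poly B g) \<notin> R"
    if A: "over L A" "over L B" "A \<noteq> 0" "degree A < degree B" for A B
  proof
    assume "inverse (poly A g / poly B g) \<in> R"
    then obtain e where "inverse (poly A g / poly B g) ^ (p ^ e) \<in> V" by (auto simp: R_def)
    then obtain C D where C: "over L C" "over L D" "D \<noteq> 0" "degree C \<le> degree D"
      and eq: "inverse (poly A g / poly B g) ^ (p ^ e) = poly C g / poly D g"
      by (rule V_E)
    have B0: "B \<noteq> 0" using A by auto
    have n: "p ^ e > 0" using p by simp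
    have "poly (B ^ (p ^ e) * D - C * A ^ (p ^ e)) g = 0"
      using eq nz[OF A(1,3)] nz[OF C(2,3)] by (simp add: field_simps power_divide)
    then have eq': "B ^ (p ^ e) * D = C * A ^ (p ^ e)"
      using trans[of "B ^ (p ^ e) * D - C * A ^ (p ^ e)"] A C by (simp add: over_closed[OF L])
    then have C0: "C \<noteq> 0" using B0 C(3) by auto
    have "degree (B ^ (p ^ e) * D) = p ^ e * degree B + degree D"
      using B0 C(3) by (simp add: degree_mult_eq degree_power_eq)
    moreover have "degree (C * A ^ (p ^ e)) = degree C + p ^ e * degree A"
      using C0 A(3) by (simp add: degree_mult_eq degree_power_eq)
    moreover have "p ^ e * degree A < p ^ e * degree B" using n A(4) by simp
    ultimately show False using eq' C(4) by simp
  qed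
  have val: "valuation_ring R"
    unfolding valuation_ring_def
  proof (intro conjI ballI allI impI)
    show "0 \<in> R" "1 \<in> R" using R_V const subfieldD[OF L] by auto
  next
    fix x y assume "x \<in> R" "y \<in> R"
    then obtain e f where ef: "x ^ (p ^ e) \<in> V" "y ^ (p ^ f) \<in> V" by (auto simp: R_def)
    have x: "x ^ (p ^ (e + f)) \<in> V" using R_lift ef by blast
    have y: "y ^ (p ^ (e + f)) \<in> V" using R_lift[of y f e] ef by (simp add: add.commute)
    show "x + y \<in> R" "x * y \<in> R"
      using V_add[OF x y] V_mult[OF x y] frob[of x y "e + f"]
      by (auto simp: R_def power_mult_distrib intro!: exI[of _ "e + f"])
    have "- 1 \<in> V" using const subfieldD[OF L] by simp
    from V_mult[OF V_power[OF this] ef(1), of "p ^ e"] have "(- x) ^ (p ^ e) \<in> V"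
      by (metis mult_minus1 power_mult_distrib)
    then show "- x \<in> R" by (auto simp: R_def)
  next
    fix x :: 'K
    assume "x \<noteq> 0"
    obtain e where "x ^ (p ^ e) \<in> gen_field (L \<union> {g})" using insep by (auto simp: purely_insep_def)
    with gen_field_simple[OF L, of g]
    have "x ^ (p ^ e) \<in> {poly P g / poly Q g | P Q. over L P \<and> over L Q \<and> poly Q g \<noteq> 0}"
      by (rule subsetD)
    then obtain P Q where P: "over L P" "over L Q" "poly Q g \<noteq> 0" "x ^ (p ^ e) = poly P g / poly Q g"
      by blast
    have "poly P g \<noteq> 0" using P(4) \<open>x \<noteq> 0\<close> by (metis div_0 power_not_zero)
    then have "P \<noteq> 0" "Q \<noteq> 0" using P(3) by auto
    then consider "poly P g / poly Q g \<in> V" | "poly Q g / poly P g \<in> V"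
      using V_I[OF P(1,2)] V_I[OF P(2,1)] by linarith
    then show "x \<in> R \<or> inverse x \<in> R"
    proof cases
      case 1
      then have "x ^ (p ^ e) \<in> V" using P(4) by metis
      then show ?thesis unfolding R_def by blast
    next
      case 2
      then have "inverse x ^ (p ^ e) \<in> V" using P(4) by (metis inverse_divide power_inverse)
      then show ?thesis unfolding R_def by blast
    qed
  qed
  have res: "\<exists>e. \<exists>y\<in>L. x ^ (p ^ e) - y \<in> max_ideal R" if xR: "x \<in> R" for x
  proof -
    obtain e where "x ^ (p ^ e) \<in> V" using xR by (auto simp: R_def)
    then obtain A B where A: "over L A" "over L B" "B \<noteq> 0" "degree A \<le> degree B"
      and x: "x ^ (p ^ e) = poly A g / poly B g" by (rule V_E)
    \<comment> \<open>\<open>c\<close> is the value of \<open>A / B\<close> at infinity, which is 0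
      if \<open>degree A < degree B\<close>. Subtracting \<open>smult c B\<close> removes the top
      coefficient, so \<open>x ^ (p ^ e) - c\<close> vanishes at infinity.\<close>
    define c where "c = coeff A (degree B) / lead_coeff B"
    have c: "c \<in> L" unfolding c_def using A by (auto simp: over_def intro: subfieldD[OF L])
    have C: "over L (A - smult c B)" using A c by (simp add: over_closed[OF L])
    have "coeff (A - smult c B) (degree B) = 0" using A(3) by (simp add: c_def)
    moreover have "degree (A - smult c B) \<le> degree B"
      using A(4) by (simp add: degree_diff_le)
    ultimately have deg: "A - smult c B = 0 \<or> degree (A - smult c B) < degree B"
      using eq_zero_or_degree_less by blast
    have eq: "x ^ (p ^ e) - c = poly (A - smult c B) g / poly B g"
      using nz[OF A(2,3)] by (simp add: x diff_divide_distrib)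
    have "poly (A - smult c B) g / poly B g \<in> R"
      using R_V[OF V_I[OF C A(2,3)]] deg by auto
    moreover have "poly (A - smult c B) g / poly B g = 0 \<or>
        inverse (poly (A - smult c B) g / poly B g) \<notin> R"
      using pole[OF C A(2)] deg by (cases "A - smult c B = 0") auto
    ultimately have "x ^ (p ^ e) - c \<in> max_ideal R" unfolding eq max_ideal_def by blast
    with c show ?thesis by blast
  qed
  have "g \<notin> R"
    using pole[of 1 "[:0,1:]"] by (simp add: over_1[OF L] over_0[OF L] over_pCons[OF L] subfieldD[OF L])
  with val res const R_V show ?thesis by blast
qed

section \<open>Localisation at a prime element\<close>

lemma irreducible_imp_prime_elem_ufd:
  fixes p :: "'a::ufd"
  assumes "irreducible p"
  shows "prime_elem p"
proof (rule prime_elemI)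
  show "p \<noteq> 0" "\<not> p dvd 1" using assms by (auto simp: irreducible_def)
next
  fix a b assume ab: "p dvd a * b"
  show "p dvd a \<or> p dvd b"
  proof (cases "p dvd a")
    case False
    \<comment> \<open>A divisor of the irreducible \<open>p\<close> is a unit or a multiple of
      \<open>p\<close>, and a multiple of \<open>p\<close> cannot divide \<open>a\<close>.\<close>
    have "Unique_Factorization.coprime p a"
    proof (rule Unique_Factorization.coprimeI)
      fix r assume r: "r dvd p" "r dvd a"
      then have "\<not> p dvd r" using False dvd_trans by blast
      then show "r dvd 1" using irreducibleD'[OF assms r(1)] by blast
    qed
    moreover obtain c where "a * b = p * c" using ab by blast
    ultimately show ?thesis
      using some_gcd.coprime_mult_cross_dvd(1)[of p a c b] by (simp add: mult.commute)
  qed simp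
qed

text \<open>Irreducible factors are prime here, so a factorisation can be peeled off one prime at a
  time.\<close>

lemma ufd_prime_induct [consumes 1, case_names unit prime]:
  fixes x :: "'a::ufd"
  assumes "x \<noteq> 0" and unit: "\<And>u. u dvd 1 \<Longrightarrow> P u"
    and prime: "\<And>p x. prime_elem p \<Longrightarrow> x \<noteq> 0 \<Longrightarrow> P x \<Longrightarrow> P (p * x)"
  shows "P x"
proof (cases "x dvd 1")
  case False
  then obtain F where F: "mset_factors F x" using mset_factors_exist assms(1) by blast
  have "prod_mset F \<noteq> 0 \<and> P (prod_mset F)" if "\<And>f. f \<in># F \<Longrightarrow> irreducible f"
    using that
  proof (induction F)
    case (add f F)
    then have "prime_elem f" using irreducible_imp_prime_elem_ufd by auto
    with add prime show ?case by auto
  qed (simp add: unit)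
  with F show ?thesis by (auto simp: mset_factors_def)
qed (rule unit)

lemma ufd_multiplicity:
  fixes b :: "'a::ufd"
  assumes "prime_elem q" "b \<noteq> 0"
  shows "\<exists>n c. b = q ^ n * c \<and> \<not> q dvd c"
  using assms(2)
proof (induction rule: ufd_prime_induct)
  case (unit u)
  have "\<not> q dvd u"
  proof
    assume "q dvd u"
    then have "q dvd 1" using unit by (rule dvd_trans)
    with prime_elem_not_unit[OF assms(1)] show False by blast
  qed
  then show ?case by (intro exI[of _ "0::nat"] exI[of _ u]) simp
next
  case (prime p x)
  from prime.IH obtain n c where c: "x = q ^ n * c" "\<not> q dvd c" by auto
  show ?case
  proof (cases "q dvd p")
    case True
    then obtain r where r: "p = q * r" by (elim dvdE)
    moreover have "irreducible p" using prime by (simp add: prime_elem_imp_irreducible)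
    \<comment> \<open>Irreducibility of \<open>p\<close> makes the cofactor \<open>r\<close> a unit,
      so multiplying \<open>c\<close> by it creates no factor \<open>q\<close>.\<close>
    ultimately have "r dvd 1" using irreducibleD[of p q r] prime_elem_not_unit[OF assms(1)] by blast
    then obtain w where w: "1 = r * w" by (elim dvdE)
    then have "c = r * c * w" by (metis mult.assoc mult.commute mult_1)
    then have "\<not> q dvd r * c" using c(2) by (metis dvd_mult2)
    then show ?thesis
      by (intro exI[of _ "Suc n"] exI[of _ "r * c"]) (simp add: r c(1) ac_simps)
  next
    case False
    with c assms(1) have "\<not> q dvd p * c" by (simp add: prime_elem_dvd_mult_iff)
    then show ?thesis
      by (intro exI[of _ n] exI[of _ "p * c"]) (simp add: c(1) ac_simps)
  qed
qed

text \<open>A zero denominator is excluded implicitly, since \<open>q dvd 0\<close>.\<close>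

definition localization_at :: "'a::idom \<Rightarrow> 'a fract set" where
  "localization_at q = {Fract a b | a b. \<not> q dvd b}"

lemma localization_atI: "\<not> q dvd b \<Longrightarrow> Fract a b \<in> localization_at q"
  by (auto simp: localization_at_def)

text \<open>Once the powers of \<open>q\<close> are split off numerator and denominator, comparing
  the two exponents decides whether \<open>x\<close> or \<open>1 / x\<close> belongs to the
  ring.\<close>

lemma valuation_ring_localization_at:
  fixes q :: "'a::ufd"
  assumes q: "prime_elem q"
  shows "valuation_ring (localization_at q)"
  unfolding valuation_ring_def
proof (intro conjI ballI allI impI)
  have "\<not> q dvd 1" using q by (rule prime_elem_not_unit)
  then show "0 \<in> localization_at q" "1 \<in> localization_at q"
    using localization_atI[of q 1] by (auto simp: Zero_fract_def One_fract_def)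
next
  fix x y assume "x \<in> localization_at q" "y \<in> localization_at q"
  then obtain a b c d where *: "x = Fract a b" "\<not> q dvd b" "y = Fract c d" "\<not> q dvd d"
    by (auto simp: localization_at_def)
  then have "b \<noteq> 0" "d \<noteq> 0" "\<not> q dvd b * d" using q by (auto simp: prime_elem_dvd_mult_iff)
  with * show "x + y \<in> localization_at q" "x * y \<in> localization_at q" "- x \<in> localization_at q"
    by (auto intro!: localization_atI)
next
  fix x :: "'a fract"
  assume "x \<noteq> 0"
  obtain a b where x: "x = Fract a b" "b \<noteq> 0" by (cases x)
  with \<open>x \<noteq> 0\<close> have "a \<noteq> 0" by (auto simp: fract_collapse)
  obtain n c m d where a: "a = q ^ n * c" "\<not> q dvd c" and b: "b = q ^ m * d" "\<not> q dvd d"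
    using ufd_multiplicity[OF q \<open>a \<noteq> 0\<close>] ufd_multiplicity[OF q \<open>b \<noteq> 0\<close>] by blast
  have nz: "q \<noteq> 0" "c \<noteq> 0" "d \<noteq> 0" using q a b by auto
  show "x \<in> localization_at q \<or> inverse x \<in> localization_at q"
  proof (cases "m \<le> n")
    case True
    then have "q ^ n = q ^ m * q ^ (n - m)" by (simp flip: power_add)
    with nz have "x = Fract (q ^ (n - m) * c) d" by (simp add: x a b eq_fract ac_simps)
    with b show ?thesis by (auto intro: localization_atI)
  next
    case False
    then have "q ^ m = q ^ n * q ^ (m - n)" by (simp flip: power_add)
    with nz have "inverse x = Fract (q ^ (m - n) * d) c" by (simp add: x a b eq_fract ac_simps)
    with a show ?thesis by (auto intro: localization_atI)
  qed
qed

lemma localization_at_proper: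
  assumes q: "prime_elem q"
  shows "localization_at q \<noteq> UNIV"
proof
  assume "localization_at q = UNIV"
  then have "Fract 1 q \<in> localization_at q" by simp
  then obtain a b where "Fract 1 q = Fract a b" "\<not> q dvd b" by (auto simp: localization_at_def)
  moreover have "q \<noteq> 0" using q by auto
  ultimately have "b = q * a" by (metis dvd_0_right eq_fract(1) mult.commute mult_1)
  with \<open>\<not> q dvd b\<close> show False by simp
qed

text \<open>A prime of the denominator that divides no element of \<open>S\<close> cancels against
  the numerator, because \<open>t\<close> is regular at it. A prime \<open>p\<close> with
  \<open>s = p * r\<close> in \<open>S\<close> is absorbed through
  \<open>1 / p = r / s\<close>.\<close>

lemma fract_in_localization:
  fixes S :: "'a::ufd set"
  assumes S: "1 \<in> S" "0 \<notin> S" "\<And>s t. s \<in> S \<Longrightarrow> t \<in> S \<Longrightarrow> s * t \<in> S"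
    and t: "\<And>q. prime_elem q \<Longrightarrow> \<forall>s\<in>S. \<not> q dvd s \<Longrightarrow> t \<in> localization_at q"
  shows "\<exists>a. \<exists>s\<in>S. t = Fract a s"
proof -
  obtain a b where ab: "t = Fract a b" "b \<noteq> 0" by (cases t)
  \<comment> \<open>The fraction has to vary in the induction: a prime dividing an element of
    \<open>S\<close> is treated by passing from \<open>t\<close> to \<open>p * t\<close>.\<close>
  have "\<forall>a t. t = Fract a b \<longrightarrow>
      (\<forall>q. prime_elem q \<longrightarrow> (\<forall>s\<in>S. \<not> q dvd s) \<longrightarrow> t \<in> localization_at q) \<longrightarrow>
      (\<exists>a. \<exists>s\<in>S. t = Fract a s)"
    using ab(2)
  proof (induction b rule: ufd_prime_induct)
    case (unit u)
    then obtain v where v: "1 = u * v" by blast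
    then have "u \<noteq> 0" by auto
    then have "Fract a u = Fract (a * v) 1" for a
      using v by (simp add: eq_fract) (metis mult.assoc mult.commute mult_1)
    then show ?case using S(1) by metis
  next
    case (prime p b)
    show ?case
    proof (intro allI impI)
      fix a t
      assume t: "t = Fract a (p * b)"
        and loc: "\<forall>q. prime_elem q \<longrightarrow> (\<forall>s\<in>S. \<not> q dvd s) \<longrightarrow> t \<in> localization_at q"
      have p0: "p \<noteq> 0" using prime by auto
      show "\<exists>a. \<exists>s\<in>S. t = Fract a s"
      proof (cases "\<forall>s\<in>S. \<not> p dvd s")
        case True
        with loc prime(1) obtain c d where d: "t = Fract c d" "\<not> p dvd d"
          by (auto simp: localization_at_def)
        then have d0: "d \<noteq> 0" by auto
        with d t prime(2) p0 have eq: "a * d = c * (p * b)" by (simp add: eq_fract)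
        then have "p dvd a * d" by simp
        then obtain a' where a': "a = p * a'"
          using d(2) prime(1) by (auto simp: prime_elem_dvd_mult_iff)
        then have "t = Fract a' b" using t prime(2) p0 by (simp add: eq_fract)
        with prime(3)[rule_format, of t a'] loc show ?thesis by simp
      next
        case False
        then obtain s where "s \<in> S" "p dvd s" by blast
        then obtain r where s: "s \<in> S" "s = p * r" by (elim dvdE)
        have "Fract p 1 * t = Fract a b" using t prime(2) p0 by (simp add: eq_fract)
        moreover have "Fract p 1 * t \<in> localization_at q"
          if "prime_elem q" "\<forall>s\<in>S. \<not> q dvd s" for q
          using that loc S(1)
          by (intro val_mult[OF valuation_ring_localization_at]) (auto intro: localization_atI)
        ultimately have "\<exists>a. \<exists>s\<in>S. Fract p 1 * t = Fract a s"
          by (intro prime(3)[rule_format]) auto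
        then obtain c s' where c: "s' \<in> S" "Fract p 1 * t = Fract c s'" by blast
        have nz: "s' \<noteq> 0" "s \<noteq> 0" using S(2) s(1) c(1) by auto
        have "Fract p 1 \<noteq> 0" using p0 by (simp add: Zero_fract_def eq_fract)
        then have "t = (Fract p 1 * t) / Fract p 1" by simp
        then have "t = Fract c s' / Fract p 1" unfolding c(2) .
        also have "\<dots> = Fract (c * r) (s * s')" using nz s(2) p0 by (simp add: eq_fract ac_simps)
        finally show ?thesis using S(3) s(1) c(1) by blast
      qed
    qed
  qed
  with ab(1) t show ?thesis by simp
qed


section \<open>The ring \<open>k[F]\<close> and the field \<open>k(F)\<close>\<close>

definition subst_poly :: "'k::field poly poly \<Rightarrow> 'k poly \<Rightarrow> 'k poly poly" where
  "subst_poly F r = poly (map_poly (\<lambda>c. [:[:c:]:]) r) F"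

lemma kpoly_in_eq: "kpoly_in F = range (subst_poly F)"
  by (auto simp: kpoly_in_def subst_poly_def)

lemma subst_poly_0 [simp]: "subst_poly F 0 = 0"
  by (simp add: subst_poly_def)

lemma subst_poly_pCons: "subst_poly F (pCons c r) = [:[:c:]:] + F * subst_poly F r"
  by (cases "c = 0 \<and> r = 0") (auto simp: subst_poly_def map_poly_pCons)

lemma subst_poly_add: "subst_poly F (r + s) = subst_poly F r + subst_poly F s"
proof (induction r s rule: poly_induct2)
  case (pCons a r b s)
  have "[:[:a + b:]:] = [:[:a:]:] + [:[:b:]:]" by simp
  with pCons show ?case
    by (simp only: subst_poly_pCons add_pCons distrib_left add_ac)
qed simp

lemma subst_poly_smult: "subst_poly F (smult c r) = [:[:c:]:] * subst_poly F r"
proof (induction r)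
  case (pCons a r)
  have const: "[:[:c * a:]:] = [:[:c:]:] * [:[:a:]:]" by simp
  show ?case
    by (simp only: smult_pCons subst_poly_pCons pCons.IH const distrib_left
        mult.left_commute[of F "[:[:c:]:]"])
qed simp

lemma subst_poly_mult: "subst_poly F (r * s) = subst_poly F r * subst_poly F s"
proof (induction r)
  case (pCons a r)
  then show ?case
    by (simp only: mult_pCons_left subst_poly_pCons subst_poly_add subst_poly_smult distrib_right
        pCons_0_0 add_0 mult.assoc)
qed simp

lemma kpoly_in_const: "[:[:c:]:] \<in> kpoly_in F"
proof -
  have "[:[:c:]:] = subst_poly F [:c:]" by (simp add: subst_poly_pCons)
  then show ?thesis unfolding kpoly_in_eq by simp
qed

lemma kpoly_in_self: "F \<in> kpoly_in F"
proof -
  have "subst_poly F (pCons 0 (pCons 1 0)) = F"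
    by (simp only: subst_poly_pCons subst_poly_0) simp
  then show ?thesis unfolding kpoly_in_eq by (metis rangeI)
qed

lemma kpoly_in_add: "a \<in> kpoly_in F \<Longrightarrow> b \<in> kpoly_in F \<Longrightarrow> a + b \<in> kpoly_in F"
  and kpoly_in_mult: "a \<in> kpoly_in F \<Longrightarrow> b \<in> kpoly_in F \<Longrightarrow> a * b \<in> kpoly_in F"
  by (auto simp: kpoly_in_eq simp flip: subst_poly_add subst_poly_mult)

lemma kpoly_in_1: "1 \<in> kpoly_in F"
  using kpoly_in_const[of 1 F] by simp

lemma kpoly_in_uminus: "a \<in> kpoly_in F \<Longrightarrow> - a \<in> kpoly_in F"
proof -
  have minus: "subst_poly F (- r) = - subst_poly F r" for r
    using subst_poly_add[of F r "- r"] by (simp add: eq_neg_iff_add_eq_0 add.commute)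
  show "a \<in> kpoly_in F \<Longrightarrow> - a \<in> kpoly_in F"
    unfolding kpoly_in_eq by (auto simp flip: minus)
qed

lemma emb_add: "emb (a + b) = emb a + emb b"
  and emb_mult: "emb (a * b) = emb a * emb b"
  by (simp_all add: emb_def)

lemma emb_divide: "emb a / emb b = Fract a b"
  by (simp add: emb_def)

lemma kF_subfield: "is_subfield (kF F)"
  unfolding kF_def by (rule gen_field_subfield)

lemma emb_kpoly_in: "s \<in> kpoly_in F \<Longrightarrow> emb s \<in> kF F"
proof -
  have *: "emb F \<in> kF F" "emb [:[:c:]:] \<in> kF F" for c
    using gen_field_incl[of "kconst \<union> {emb F}"] unfolding kF_def kconst_def by auto
  have "emb (subst_poly F r) \<in> kF F" for r
  proof (induction r)
    case 0
    then show ?case using subfieldD(1)[OF kF_subfield] by (simp add: emb_def Zero_fract_def)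
  next
    case (pCons c r)
    then show ?case
      unfolding subst_poly_pCons emb_add emb_mult using * by (intro subfieldD[OF kF_subfield])
  qed
  then show "s \<in> kpoly_in F \<Longrightarrow> emb s \<in> kF F" by (auto simp: kpoly_in_eq)
qed

lemma kF_fractions: "kF F \<subseteq> {Fract a s | a s. a \<in> kpoly_in F \<and> s \<in> kpoly_in F \<and> s \<noteq> 0}"
  (is "_ \<subseteq> ?Q")
proof -
  have I: "Fract a s \<in> ?Q" if "a \<in> kpoly_in F" "s \<in> kpoly_in F" "s \<noteq> 0" for a s
    using that by blast
  have k0: "0 \<in> kpoly_in F" unfolding kpoly_in_eq by (metis rangeI subst_poly_0)
  show ?thesis
    unfolding kF_def
  proof (rule gen_field_least)
    show "is_subfield ?Q"
      unfolding is_subfield_def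
    proof (intro conjI ballI)
      show "0 \<in> ?Q" "1 \<in> ?Q"
        using I[OF k0 kpoly_in_1] I[OF kpoly_in_1 kpoly_in_1] by (simp_all add: Zero_fract_def One_fract_def)
    next
      fix x y assume "x \<in> ?Q" "y \<in> ?Q"
      then obtain a s b t where *: "x = Fract a s" "a \<in> kpoly_in F" "s \<in> kpoly_in F" "s \<noteq> 0"
        "y = Fract b t" "b \<in> kpoly_in F" "t \<in> kpoly_in F" "t \<noteq> 0" by blast
      then show "x + y \<in> ?Q" "x * y \<in> ?Q"
        using I[of "a * t + b * s" "s * t"] I[of "a * b" "s * t"]
        by (simp_all add: kpoly_in_add kpoly_in_mult)
    next
      fix x assume "x \<in> ?Q"
      then obtain a s where *: "x = Fract a s" "a \<in> kpoly_in F" "s \<in> kpoly_in F" "s \<noteq> 0" by blast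
      then show "- x \<in> ?Q" using I[of "- a" s] by (simp add: kpoly_in_uminus)
      show "inverse x \<in> ?Q"
      proof (cases "a = 0")
        case True
        with * have "inverse x = Fract 0 1" by (simp add: fract_collapse)
        then show ?thesis using I[OF k0 kpoly_in_1] by simp
      next
        case False
        with * I[of s a] show ?thesis by simp
      qed
    qed
    show "kconst \<union> {emb F} \<subseteq> ?Q"
      using I[OF kpoly_in_const kpoly_in_1] I[OF kpoly_in_self kpoly_in_1]
      by (auto simp: kconst_def emb_def)
  qed
qed

text \<open>For prime \<open>q\<close> this yields a valuation ring over \<open>k(F)\<close> that
  contains \<open>loc_ring F\<close> and therefore is not a dicritical.\<close>

lemma kF_localization_at:
  assumes "\<forall>s\<in>kpoly_in F - {0}. \<not> q dvd s"
  shows "kF F \<subseteq> localization_at q" "loc_ring F \<subseteq> localization_at q"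
proof -
  have "Fract a s \<in> localization_at q" if "s \<in> kpoly_in F" "s \<noteq> 0" for a s
    using assms that by (intro localization_atI) simp
  then show "loc_ring F \<subseteq> localization_at q" "kF F \<subseteq> localization_at q"
    using kF_fractions[of F] by (auto simp: loc_ring_def)
qed

section \<open>Primes dividing no nonzero element of \<open>k[F]\<close>\<close>

lemma prime_elem_linear:
  fixes a :: "'a::idom"
  shows "prime_elem [:- a, 1:]"
proof -
  have dvd: "[:- a, 1:] dvd p \<longleftrightarrow> poly p a = 0" for p by (simp only: poly_eq_0_iff_dvd)
  show ?thesis by (rule prime_elemI) (simp_all only: dvd poly_mult, auto)
qed

lemma alg_closed_non_root:
  fixes c :: "'k::field poly"
  assumes "alg_closed TYPE('k)" "c \<noteq> 0"
  shows "\<exists>a. poly c a \<noteq> 0"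
proof -
  \<comment> \<open>Closedness is applied to \<open>X * c - 1\<close>: at a root \<open>a\<close> of
    it, \<open>a * c(a) = 1\<close>.\<close>
  have "degree (pCons (- 1) c) > 0" using assms(2) by simp
  then obtain a where "poly (pCons (- 1) c) a = 0" using assms(1) unfolding alg_closed_def by blast
  then have "a * poly c a = 1" by simp
  then show ?thesis by (intro exI[of _ a]) auto
qed

text \<open>The prime is the equation of a line on which \<open>F\<close> is not constant, if \<open>F \<notin> k\<close>.\<close>
lemma prime_avoiding_kpoly_in:
  fixes F :: "'k::field poly poly"
  assumes "alg_closed TYPE('k)"
  shows "\<exists>q. prime_elem q \<and> (\<forall>s\<in>kpoly_in F - {0}. \<not> q dvd s)"
proof (cases "degree F = 0")
  case True
  then obtain f where f: "F = [:f:]" by (rule degree_eq_zeroE)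
  \<comment> \<open>All of \<open>k[F]\<close> is constant in the outer variable, so that variable
    is a suitable prime.\<close>
  have const: "degree (subst_poly F r) = 0" for r
  proof (induction r)
    case (pCons c r)
    from pCons.IH obtain g where "subst_poly F r = [:g:]" by (rule degree_eq_zeroE)
    then show ?case by (simp add: subst_poly_pCons f)
  qed simp
  have "\<not> [:- 0, 1:] dvd s" if s: "s \<in> kpoly_in F - {0}" for s
  proof -
    have "degree s = 0" "s \<noteq> 0" using s const by (auto simp: kpoly_in_eq)
    then obtain g where "s = [:g:]" "g \<noteq> 0" by (metis degree_eq_zeroE pCons_0_0)
    then have "poly s 0 \<noteq> 0" by simp
    then show ?thesis by (simp add: poly_eq_0_iff_dvd)
  qed
  with prime_elem_linear[of "0 :: 'k poly"] show ?thesis by (intro exI conjI) auto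
next
  case False
  then have "lead_coeff F \<noteq> 0" by auto
  then obtain a where a: "poly (lead_coeff F) a \<noteq> 0" using alg_closed_non_root[OF assms] by blast
  \<comment> \<open>\<open>\<phi>\<close> restricts to the line where the inner variable equals
    \<open>a\<close>. There \<open>F\<close> stays nonconstant, so \<open>r(F)\<close> restricts to
    a nonzero polynomial unless \<open>r = 0\<close>.\<close>
  define \<phi> where "\<phi> = (map_poly (\<lambda>g. poly g a) :: 'k poly poly \<Rightarrow> 'k poly)"
  have hom: "\<phi> (p + q) = \<phi> p + \<phi> q" for p q
    by (rule poly_eqI) (simp add: \<phi>_def coeff_map_poly)
  have hom_mult: "\<phi> (p * q) = \<phi> p * \<phi> q" for p q
    by (rule poly_eqI) (simp add: \<phi>_def coeff_map_poly coeff_mult poly_sum)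
  have deg: "degree (\<phi> F) > 0"
  proof -
    have "coeff (\<phi> F) (degree F) \<noteq> 0" using a by (simp add: \<phi>_def coeff_map_poly)
    then have "degree F \<le> degree (\<phi> F)" by (rule le_degree)
    with False show ?thesis by simp
  qed
  have comp: "\<phi> (subst_poly F r) = pcompose r (\<phi> F)" for r
  proof (induction r)
    case 0
    then show ?case by (simp add: \<phi>_def)
  next
    case (pCons c r)
    have "\<phi> [:[:c:]:] = [:c:]"
      by (rule poly_eqI) (simp add: \<phi>_def coeff_map_poly coeff_pCons split: nat.splits)
    with pCons show ?case by (simp add: subst_poly_pCons hom hom_mult pcompose_pCons)
  qed
  let ?q = "[:[:- a, 1:]:]"
  have "\<not> ?q dvd s" if s: "s \<in> kpoly_in F - {0}" for s
  proof
    assume "?q dvd s"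
    obtain r where r: "s = subst_poly F r" using s by (auto simp: kpoly_in_eq)
    from \<open>?q dvd s\<close> have "\<forall>n. [:- a, 1:] dvd coeff s n" by (simp add: const_poly_dvd_iff)
    then have "\<forall>n. poly (coeff s n) a = 0" by (simp add: poly_eq_0_iff_dvd)
    then have "\<phi> s = 0" by (intro poly_eqI) (simp add: \<phi>_def coeff_map_poly)
    then have "r = 0" using pcompose_eq_0[OF _ deg] comp r by metis
    with r s show False by simp
  qed
  moreover have "prime_elem ?q" by (simp only: prime_elem_const_poly_iff prime_elem_linear)
  ultimately show ?thesis by (intro exI[of _ ?q] conjI ballI)
qed

section \<open>The two implications of the equivalence\<close>

lemma good_imp_purely_insep_dicritical:
  fixes F :: "'k::field poly poly"
  assumes "alg_closed TYPE('k)" "good_pseudo_field_generator F"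
  shows "\<exists>R\<in>dicriticals F. purely_insep_dicritical F R"
proof -
  let ?p = "char_exp TYPE('k)" and ?L = "kF F"
  obtain G :: "'k poly poly" where
    G: "purely_insep ?p (gen_field (kconst \<union> {emb F, emb G})) UNIV"
    using assms(2) unfolding good_pseudo_field_generator_def by auto
  have "kconst \<union> {emb F, emb G} \<subseteq> gen_field (?L \<union> {emb G})"
    using gen_field_incl[of "?L \<union> {emb G}"] gen_field_incl[of "kconst \<union> {emb F}"]
    unfolding kF_def by blast
  then have insep: "purely_insep ?p (gen_field (?L \<union> {emb G})) UNIV"
    by (intro purely_insep_trans[OF gen_field_subfield char_exp_pos _ G char_exp_frobenius, where f = 0]) auto
  \<comment> \<open>The localisation at \<open>q\<close> is a proper valuation ring over
    \<open>k(F)\<close>, which makes \<open>emb G\<close> transcendental over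
    \<open>k(F)\<close>.\<close>
  obtain q where q: "prime_elem q" "\<forall>s\<in>kpoly_in F - {0}. \<not> q dvd s"
    using prime_avoiding_kpoly_in[OF assms(1), of F] by (elim exE conjE) (rule that)
  have trans: "P = 0" if "over ?L P" "poly P (emb G) = 0" for P
    using transcendental_if_purely_insep[OF kF_subfield valuation_ring_localization_at[OF q(1)]
        kF_localization_at(1)[OF q(2)] localization_at_proper[OF q(1)] char_exp_pos insep that] .
  obtain R where R: "valuation_ring R" "?L \<subseteq> R" "emb G \<notin> R"
    and res: "\<forall>x\<in>R. \<exists>e. \<exists>y\<in>?L. x ^ (?p ^ e) - y \<in> max_ideal R"
    using place_at_infinity[OF kF_subfield char_exp_pos char_exp_frobenius insep trans] by blast
  have frac: "\<exists>a\<in>R. \<exists>b\<in>R. b \<noteq> 0 \<and> z = a / b" for z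
  proof (cases "z \<in> R")
    case True
    then show ?thesis using val_1[OF R(1)] by (intro bexI[of _ z] bexI[of _ 1]) auto
  next
    case False
    then have "inverse z \<in> R" "z \<noteq> 0" using val_total[OF R(1)] val_0[OF R(1)] by auto
    then show ?thesis
      using val_1[OF R(1)] by (intro bexI[of _ 1] bexI[of _ "inverse z"]) (auto simp: field_simps)
  qed
  \<comment> \<open>This is where \<open>G\<close> in \<open>A\<close> matters: \<open>emb G\<close>
    is an element of \<open>loc_ring F\<close> outside \<open>R\<close>.\<close>
  have "emb G \<in> loc_ring F"
    unfolding loc_ring_def emb_def using kpoly_in_1[of F] by fastforce
  with R frac have "R \<in> dicriticals F" unfolding dicriticals_def by blast
  moreover have "purely_insep_dicritical F R" unfolding purely_insep_dicritical_def using res .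
  ultimately show ?thesis by blast
qed

lemma purely_insep_dicritical_imp_good:
  fixes F :: "'k::field poly poly"
  assumes "pseudo_field_generator F" "R \<in> dicriticals F" "purely_insep_dicritical F R"
  shows "good_pseudo_field_generator F"
proof -
  let ?p = "char_exp TYPE('k)" and ?L = "kF F"
  obtain G where G: "purely_insep ?p (gen_field (kconst \<union> {emb F, G})) UNIV"
    using assms(1) unfolding pseudo_field_generator_def by blast
  have R: "valuation_ring R" "?L \<subseteq> R" "R \<noteq> UNIV" "\<not> loc_ring F \<subseteq> R"
    using assms(2) by (auto simp: dicriticals_def)
  have gens: "kconst \<subseteq> ?L" "emb F \<in> ?L"
    using gen_field_incl[of "kconst \<union> {emb F}"] unfolding kF_def by auto
  have pow_R: "z \<in> R" if "z ^ (?p ^ e) \<in> R" for z e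
    using val_root[OF R(1) that] by (simp add: char_exp_pos)
  \<comment> \<open>Only a power of \<open>G\<close> has to be found in \<open>L(u)\<close>, because
    the other generators already lie in \<open>L\<close>.\<close>
  have insep_I: "purely_insep ?p (gen_field (?L \<union> {u})) UNIV"
    if "G ^ (?p ^ e) \<in> gen_field (?L \<union> {u})" for u e
  proof (rule purely_insep_trans[OF gen_field_subfield char_exp_pos _ G char_exp_frobenius])
    have "?L \<subseteq> gen_field (?L \<union> {u})" using gen_field_incl by blast
    then show "kconst \<union> {emb F, G} \<subseteq> {x. x ^ (?p ^ e) \<in> gen_field (?L \<union> {u})}"
      using that gens by (auto intro!: subfieldD(9)[OF gen_field_subfield])
  qed
  obtain u where u: "u \<in> max_ideal R" "u \<noteq> 0" "purely_insep ?p (gen_field (?L \<union> {u})) UNIV"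
  proof (cases "G \<in> R")
    case True
    then obtain e y where y: "y \<in> ?L" "G ^ (?p ^ e) - y \<in> max_ideal R"
      using assms(3) unfolding purely_insep_dicritical_def by blast
    define u where "u = G ^ (?p ^ e) - y"
    have "u + y \<in> gen_field (?L \<union> {u})"
      using gen_field_incl[of "?L \<union> {u}"] y(1) by (intro subfieldD(3)[OF gen_field_subfield]) auto
    then have insep: "purely_insep ?p (gen_field (?L \<union> {u})) UNIV"
      by (intro insep_I[of e]) (simp add: u_def)
    \<comment> \<open>If \<open>u = 0\<close>, then \<open>L(u) = L\<close>, so every element of
      \<open>Frac A\<close> has a power in \<open>R\<close> and \<open>R\<close> is not
      proper.\<close>
    have "u \<noteq> 0"
    proof
      assume "u = 0"
      then have "gen_field (?L \<union> {u}) \<subseteq> ?L"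
        using subfieldD(1)[OF kF_subfield] by (intro gen_field_least[OF kF_subfield]) auto
      then have "\<exists>e. z ^ (?p ^ e) \<in> R" for z using insep R(2) unfolding purely_insep_def by blast
      then have "R = UNIV" using pow_R by blast
      with R(3) show False by simp
    qed
    with that y(2) insep show thesis unfolding u_def by blast
  next
    case False
    have "inverse G \<in> gen_field (?L \<union> {inverse G})" using gen_field_incl by blast
    from subfieldD(6)[OF gen_field_subfield this]
    have "G ^ (?p ^ 0) \<in> gen_field (?L \<union> {inverse G})" by simp
    from insep_I[OF this] inverse_max_ideal[OF R(1) False] False val_0[OF R(1)] show thesis
      by (intro that[of "inverse G"]) auto
  qed
  have "\<exists>a. \<exists>s\<in>kpoly_in F - {0}. inverse u = Fract a s"
  proof (rule fract_in_localization)
    show "1 \<in> kpoly_in F - {0}" "0 \<notin> kpoly_in F - {0}" using kpoly_in_1 by auto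
    show "s * t \<in> kpoly_in F - {0}" if "s \<in> kpoly_in F - {0}" "t \<in> kpoly_in F - {0}" for s t
      using that by (auto intro: kpoly_in_mult)
  next
    fix q :: "'k poly poly" assume q: "prime_elem q" "\<forall>s\<in>kpoly_in F - {0}. \<not> q dvd s"
    let ?V = "localization_at q"
    have V: "valuation_ring ?V" "?L \<subseteq> ?V" "loc_ring F \<subseteq> ?V"
      using valuation_ring_localization_at[OF q(1)] kF_localization_at[OF q(2)] by auto
    show "inverse u \<in> ?V"
    proof (rule ccontr)
      \<comment> \<open>Now \<open>u\<close> is a nonunit of both rings, so \<open>?V\<close> is
        contained in \<open>R\<close>, although \<open>?V\<close> contains \<open>loc_ring F\<close>
        and \<open>R\<close> does not.\<close>
      assume "inverse u \<notin> ?V"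
      from inverse_max_ideal[OF V(1) this] have "u \<in> max_ideal ?V" by simp
      from valuation_ring_le[OF kF_subfield V(1,2) this R(1,2) u(1,2) char_exp_pos u(3)]
      have "?V \<subseteq> R" .
      with V(3) R(4) show False by blast
    qed
  qed
  then obtain a s where s: "s \<in> kpoly_in F" "s \<noteq> 0" "inverse u = emb a / emb s"
    by (auto simp: emb_divide)
  \<comment> \<open>As \<open>u = s / a\<close> with \<open>s\<close> in \<open>k[F]\<close>, the
    field \<open>k(F, a)\<close> contains \<open>u\<close>, so \<open>a\<close> can replace
    \<open>u\<close> as a generator.\<close>
  have "purely_insep ?p (gen_field (kconst \<union> {emb F, emb a})) UNIV"
  proof (rule purely_insep_trans[OF gen_field_subfield char_exp_pos _ u(3) char_exp_frobenius])
    let ?M = "gen_field (kconst \<union> {emb F, emb a})"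
    have LM: "?L \<subseteq> ?M"
      unfolding kF_def using gen_field_incl[of "kconst \<union> {emb F, emb a}"]
      by (intro gen_field_least[OF gen_field_subfield]) auto
    have "emb a \<in> ?M" using gen_field_incl[of "kconst \<union> {emb F, emb a}"] by blast
    moreover have "emb s \<in> ?M" using LM emb_kpoly_in[OF s(1)] by blast
    ultimately have "emb s / emb a \<in> ?M" by (intro subfieldD(8)[OF gen_field_subfield])
    moreover have "u = emb s / emb a" using s(3) by (metis inverse_divide inverse_inverse_eq)
    ultimately have "u \<in> ?M" by simp
    with LM show "?L \<union> {u} \<subseteq> {x. x ^ (?p ^ 0) \<in> ?M}" by auto
  qed
  then show ?thesis unfolding good_pseudo_field_generator_def by blast
qed

theorem mainTheorem3:
  fixes F :: "'k::field poly poly"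
  assumes "alg_closed TYPE('k)"
    and "pseudo_field_generator F"
  shows "good_pseudo_field_generator F \<longleftrightarrow>
           (\<exists>R\<in>dicriticals F. purely_insep_dicritical F R)"
proof
  show "good_pseudo_field_generator F \<Longrightarrow> \<exists>R\<in>dicriticals F. purely_insep_dicritical F R"
    by (rule good_imp_purely_insep_dicritical[OF assms(1)])
  show "\<exists>R\<in>dicriticals F. purely_insep_dicritical F R \<Longrightarrow> good_pseudo_field_generator F"
    by (elim bexE) (rule purely_insep_dicritical_imp_good[OF assms(2)])
qed

end
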